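(* Let $C_f,C_g$ be closed convex subsets of $\mathcal H$ with $C_f\cap C_g\ne\emptyset$ such that $\{C_f,C_g\}$ is (boundedly) linearly regular, and let $(z^j)_{j\ge0}$ be generated by the iteration $$x_g^k=\mathbf{prox}_{\gamma_{g,k}d_{C_g}^2}(z^k),\qquad x_f^k=\mathbf{prox}_{\gamma_{f,k}d_{C_f}^2}(2x_g^k-z^k),\qquad z^{k+1}=z^k+2\lambda_k(x_f^k-x_g^k),$$ with $z^0\in\mathcal H$, $\gamma_{f,k},\gamma_{g,k}>0$ and $\lambda_k\in(0,1]$. Let $\rho>0$ and $\mu_\rho>0$ be such that $(z^j)_{j\ge0}\subseteq B(0,\rho)$ and $d_{C_f\cap C_g}(x)\le\mu_\rho\max\{d_{C_f}(x),d_{C_g}(x)\}$ for all $x\in B(0,\rho)$. Then for all $k\ge0$, $$d_{C_f\cap C_g}(z^{k+1})\le C(\gamma_{f,k},\gamma_{g,k},\lambda_k,\mu_\rho)\,d_{C_f\cap C_g}(z^k),$$ where $$C(\gamma_{f,k},\gamma_{g,k},\lambda_k,\mu_\rho):=\left(1-\frac{4\lambda_k\min\{\gamma_{g,k}/(2\gamma_{g,k}+1)^2,\ \gamma_{f,k}/(2\gamma_{f,k}+1)^2\}}{\mu_\rho^2\max\{16\gamma_{g,k}^2/(2\gamma_{g,k}+1)^2,\ 1\}}\right)^{1/2}.$$ In particular, if $\overline C=\sup_{j\ge0}C(\gamma_{f,j},\gamma_{g,j},\lambda_j,\mu_\rho)<1$, then $(z^j)_{j\ge0}$ converges linearly, with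 rate $\overline C$, to a point $x\in C_f\cap C_g$, and for all $k\ge0$ $$\|z^k-x\|\le2\,d_{C_f\cap C_g}(z^0)\prod_{i=0}^{k-1}C(\gamma_{f,i},\gamma_{g,i},\lambda_i,\mu_\rho).$$
   Context: $\mathcal H$ is a real Hilbert space; $d_C(x)=\inf_{y\in C}\|x-y\|$; $B(0,\rho)$ is the open ball of radius $\rho$ centered at $0$; $\mathbf{prox}_{h}(x)=\arg\min_yh(y)+\frac12\|y-x\|^2$, so that $\mathbf{prox}_{\gamma d_C^2}(x)=\arg\min_y \gamma d_C^2(y)+\frac12\|y-x\|^2$. A family $\{C_1,\dots,C_m\}$ of closed convex sets with nonempty intersection is boundedly linearly regular if for all $\rho>0$ there is $\mu_\rho>0$ such that $d_{C_1\cap\cdots\cap C_m}(x)\le\mu_\rho\max\{d_{C_1}(x),\dots,d_{C_m}(x)\}$ for all $x\in B(0,\rho)$; it is linearly regular if $\mu_\rho$ can be chosen independently of $\rho$. *)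

theory Defs
  imports "HOL-Analysis.Analysis"
begin

text \<open>A real Hilbert space is a type of sort \<open>{real_inner, complete_space}\<close>, and the distance
  function of a nonempty set \<open>C\<close> is \<open>\<lambda>x. infdist x C\<close>.\<close>

definition prox :: "('a::real_normed_vector \<Rightarrow> real) \<Rightarrow> 'a \<Rightarrow> 'a" where
  "prox h x = (ARG_MIN (\<lambda>y. h y + 1 / 2 * (norm (y - x))\<^sup>2) y. True)"

text \<open>\<open>ARG_MIN\<close> picks some minimizer. For \<open>h = (\<lambda>y. \<gamma> * (infdist y C)\<^sup>2)\<close> with \<open>\<gamma> > 0\<close> and \<open>C\<close>
  a nonempty closed convex subset of a Hilbert space, the objective is continuous and strongly
  convex, so that there is exactly one.\<close>

definition convex_family :: "'a::real_normed_vector set set \<Rightarrow> bool" where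
  "convex_family F \<longleftrightarrow>
     finite F \<and> F \<noteq> {} \<and> (\<forall>C\<in>F. closed C \<and> convex C) \<and> \<Inter>F \<noteq> {}"

definition boundedly_linearly_regular :: "'a::real_normed_vector set set \<Rightarrow> bool" where
  "boundedly_linearly_regular F \<longleftrightarrow> convex_family F \<and>
     (\<forall>\<rho>>0. \<exists>\<mu>>0. \<forall>x\<in>ball 0 \<rho>. infdist x (\<Inter>F) \<le> \<mu> * (MAX C\<in>F. infdist x C))"

definition linearly_regular :: "'a::real_normed_vector set set \<Rightarrow> bool" where
  "linearly_regular F \<longleftrightarrow> convex_family F \<and>
     (\<exists>\<mu>>0. \<forall>\<rho>>0. \<forall>x\<in>ball 0 \<rho>. infdist x (\<Inter>F) \<le> \<mu> * (MAX C\<in>F. infdist x C))"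

lemma linearly_regular_imp_boundedly_linearly_regular:
  "linearly_regular F \<Longrightarrow> boundedly_linearly_regular F"
  unfolding linearly_regular_def boundedly_linearly_regular_def by blast

text \<open>Here \<open>\<mu>\<close> is a regularity constant of two sets on a ball. If their intersection contains that
  ball, \<open>\<mu>\<close> can be so small that the radicand is negative; \<open>sqrt\<close> then returns a negative real.
  Otherwise \<open>\<mu> \<ge> 1\<close>, and the radicand is at least \<open>1 / 2\<close> for positive \<open>\<gamma>f\<close>, \<open>\<gamma>g\<close>
  and \<open>0 < l \<le> 1\<close>.\<close>

definition contraction_factor :: "real \<Rightarrow> real \<Rightarrow> real \<Rightarrow> real \<Rightarrow> real" where
  "contraction_factor \<gamma>f \<gamma>g l \<mu> =
     sqrt (1 - (4 * l * min (\<gamma>g / (2 * \<gamma>g + 1)\<^sup>2) (\<gamma>f / (2 * \<gamma>f + 1)\<^sup>2)) /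
               (\<mu>\<^sup>2 * max (16 * \<gamma>g\<^sup>2 / (2 * \<gamma>g + 1)\<^sup>2) 1))"

text \<open>Linear convergence is R-linear convergence. The rate is not required to be nonnegative, because
  of the degenerate values of \<^const>\<open>contraction_factor\<close>; a negative \<open>r\<close> forces \<open>M = 0\<close>,
  that is, \<open>z\<close> is constantly \<open>x\<close>.\<close>

definition converges_linearly :: "(nat \<Rightarrow> 'a::real_normed_vector) \<Rightarrow> 'a \<Rightarrow> real \<Rightarrow> bool" where
  "converges_linearly z x r \<longleftrightarrow>
     r < 1 \<and> z \<longlonglongrightarrow> x \<and> (\<exists>M\<ge>0. \<forall>k. norm (z k - x) \<le> M * r ^ k)"

end

theory Submission imports Defs begin

text \<open>The proximal map of \<open>\<gamma> d\<^sub>C\<^sup>2\<close> is the relaxed projection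
  \<open>x + 2\<gamma>/(2\<gamma>+1) (P\<^sub>C x - x)\<close>, so the iteration averages \<open>z\<close> with a composition of two over-relaxed
  projections whose relaxation parameters lie in \<open>(0,2)\<close>. Each of them decreases the squared distance
  to every common point by a multiple of the squared distance to the set projected on, and linear
  regularity bounds \<open>d(z\<^sup>k)\<^sup>2\<close> by these decreases. Hence \<open>(z\<^sup>k)\<close> is Fejer monotone with respect to
  the intersection and its distances contract; a Fejer monotone sequence stays within twice its
  current distance of its present position.\<close>

section \<open>Nearest points in closed convex sets\<close>

text \<open>Midpoints of a minimizing sequence stay in \<open>C\<close>, so the parallelogram
  identity bounds its mutual distances and makes it Cauchy; completeness stands in for
  compactness.\<close>

lemma infdist_attained_complete_convex:
  fixes C :: "'a::{real_inner, complete_space} set"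
  assumes "closed C" "convex C" "C \<noteq> {}"
  obtains p where "p \<in> C" "dist x p = infdist x C"
proof -
  define d where "d = infdist x C"
  have d0: "d \<ge> 0" by (simp add: d_def infdist_nonneg)
  \<comment> \<open>The slack is put on the squared distance, the quantity in the parallelogram
    identity.\<close>
  have "\<exists>c\<in>C. (dist x c)\<^sup>2 < d\<^sup>2 + 1 / real (Suc n)" for n
  proof -
    have "d < sqrt (d\<^sup>2 + 1 / real (Suc n))" by (rule real_less_rsqrt) simp
    then obtain c where c: "c \<in> C" "dist x c < sqrt (d\<^sup>2 + 1 / real (Suc n))"
      using assms(3) cINF_less_iff[of C "dist x"]
      by (auto simp: d_def infdist_notempty)
    have "(dist x c)\<^sup>2 < (sqrt (d\<^sup>2 + 1 / real (Suc n)))\<^sup>2"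
      using c(2) by (intro power_strict_mono) auto
    then show ?thesis using c(1) by (intro bexI[of _ c]) auto
  qed
  then obtain c where cC: "\<And>n. c n \<in> C"
    and c: "\<And>n. (dist x (c n))\<^sup>2 < d\<^sup>2 + 1 / real (Suc n)"
    by metis
  have c_dist: "(dist (c m) (c n))\<^sup>2 < 2 * (1 / real (Suc m)) + 2 * (1 / real (Suc n))" for m n
  proof -
    have mid: "midpoint (c m) (c n) \<in> C"
      using assms(2) cC by (metis convex_contains_segment in_mono midpoint_in_closed_segment)
    have "d\<^sup>2 \<le> (dist x (midpoint (c m) (c n)))\<^sup>2"
      using infdist_le[OF mid, of x] d0 unfolding d_def by (intro power_mono) auto
    moreover have "(dist (c m) (c n))\<^sup>2 = 2 * (dist x (c m))\<^sup>2 + 2 * (dist x (c n))\<^sup>2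
        - 4 * (dist x (midpoint (c m) (c n)))\<^sup>2"
      unfolding dist_norm midpoint_def power2_norm_eq_inner
      by (simp add: inner_commute algebra_simps)
    ultimately show ?thesis using c[of m] c[of n] by linarith
  qed
  have "Cauchy c"
  proof (rule metric_CauchyI)
    fix e :: real assume e: "e > 0"
    \<comment> \<open>Beyond \<open>N\<close> the two error terms sum to at most
      \<open>4 / real (Suc N)\<close>, hence the quarter of the squared \<open>e\<close>.\<close>
    obtain N where N: "inverse (real (Suc N)) < e\<^sup>2 / 4"
      using reals_Archimedean[of "e\<^sup>2 / 4"] e by auto
    have "dist (c m) (c n) < e" if "m \<ge> N" "n \<ge> N" for m n
    proof -
      have "1 / real (Suc m) \<le> 1 / real (Suc N)" "1 / real (Suc n) \<le> 1 / real (Suc N)"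
        using that by (auto intro!: divide_left_mono)
      then have "(dist (c m) (c n))\<^sup>2 < e\<^sup>2"
        using c_dist[of m n] N by (simp add: inverse_eq_divide)
      then show ?thesis using e power_less_imp_less_base by fastforce
    qed
    then show "\<exists>N. \<forall>m\<ge>N. \<forall>n\<ge>N. dist (c m) (c n) < e" by blast
  qed
  then obtain p where p: "c \<longlonglongrightarrow> p" using Cauchy_convergent convergent_def by blast
  have pC: "p \<in> C" using assms(1) cC p closed_sequentially by blast
  have "(dist x p)\<^sup>2 \<le> d\<^sup>2 + 0"
  proof (rule LIMSEQ_le)
    show "(\<lambda>n. (dist x (c n))\<^sup>2) \<longlonglongrightarrow> (dist x p)\<^sup>2" by (intro tendsto_intros p)
    show "(\<lambda>n. d\<^sup>2 + 1 / real (Suc n)) \<longlonglongrightarrow> d\<^sup>2 + 0"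
      using LIMSEQ_inverse_real_of_nat by (intro tendsto_intros) (simp add: inverse_eq_divide)
    show "\<exists>N. \<forall>n\<ge>N. (dist x (c n))\<^sup>2 \<le> d\<^sup>2 + 1 / real (Suc n)" using c less_imp_le by blast
  qed
  then have "dist x p \<le> d" using d0 power2_le_imp_le by simp
  then show thesis using that[OF pC] infdist_le[OF pC, of x] unfolding d_def by simp
qed

section \<open>The proximal map of a squared distance\<close>

text \<open>With the distance to \<open>C\<close> replaced by the distance to a fixed
  \<open>c\<close>, the objective is a quadratic in \<open>y\<close> with minimum
  \<open>a / 2\<close> times the squared distance from \<open>x\<close> to \<open>c\<close>.
  Minimizing over \<open>c\<close> as well selects the projection \<open>p\<close> of
  \<open>x\<close>.\<close>

lemma prox_infdist_square:
  fixes C :: "'a::{real_inner, complete_space} set"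
  assumes C: "closed C" "convex C" and \<gamma>: "\<gamma> > 0" and p: "p \<in> C" "dist x p = infdist x C"
  shows "prox (\<lambda>y. \<gamma> * (infdist y C)\<^sup>2) x = x + (2 * \<gamma> / (2 * \<gamma> + 1)) *\<^sub>R (p - x)"
proof -
  \<comment> \<open>The stationarity equation \<open>2 * \<gamma> * (a - 1) + a = 0\<close> of that
    quadratic along the line from \<open>x\<close> to \<open>c\<close>.\<close>
  define a where "a = 2 * \<gamma> / (2 * \<gamma> + 1)"
  define f where "f = (\<lambda>y. \<gamma> * (infdist y C)\<^sup>2 + 1 / 2 * (norm (y - x))\<^sup>2)"
  let ?q = "\<lambda>c. x + a *\<^sub>R (c - x)"
  have a\<gamma>: "a * (2 * \<gamma> + 1) = 2 * \<gamma>" using \<gamma> by (simp add: a_def)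
  have a0: "a > 0" using \<gamma> by (simp add: a_def)
  \<comment> \<open>Completing the square after replacing \<open>d\<^sub>C(y)\<close> by \<open>\<parallel>y - c\<parallel>\<close>.\<close>
  have square: "\<gamma> * (dist y c)\<^sup>2 + 1 / 2 * (norm (y - x))\<^sup>2
      = (\<gamma> + 1 / 2) * (norm (y - ?q c))\<^sup>2 + a / 2 * (dist x c)\<^sup>2" for y c
  proof -
    have "(norm (y - ?q c))\<^sup>2
        = (norm (y - x))\<^sup>2 - 2 * a * inner (y - x) (c - x) + a\<^sup>2 * (norm (c - x))\<^sup>2"
      unfolding power2_norm_eq_inner
      by (simp add: inner_commute algebra_simps power2_eq_square)
    moreover have "(dist y c)\<^sup>2
        = (norm (y - x))\<^sup>2 - 2 * inner (y - x) (c - x) + (norm (c - x))\<^sup>2"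
      unfolding power2_norm_eq_inner dist_norm
      by (simp add: inner_commute algebra_simps)
    moreover have "dist x c = norm (c - x)" by (simp add: dist_norm norm_minus_commute)
    moreover have "\<gamma> * (X - 2 * I + Q) + 1 / 2 * X
        = (\<gamma> + 1 / 2) * (X - 2 * a * I + a\<^sup>2 * Q) + a / 2 * Q" for X I Q
    proof -
      have "(\<gamma> + 1 / 2) * (X - 2 * a * I + a\<^sup>2 * Q) + a / 2 * Q
          = (\<gamma> + 1 / 2) * X - (a * (2 * \<gamma> + 1)) * I + (a * (2 * \<gamma> + 1) * a + a) / 2 * Q"
        by (simp add: algebra_simps power2_eq_square)
      also have "(a * (2 * \<gamma> + 1) * a + a) / 2 = a * (2 * \<gamma> + 1) / 2"
        unfolding a\<gamma> using a\<gamma> by (simp add: algebra_simps)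
      finally show ?thesis unfolding a\<gamma> by (simp add: algebra_simps)
    qed
    ultimately show ?thesis by presburger
  qed
  have fq: "f (?q p) \<le> a / 2 * (infdist x C)\<^sup>2"
  proof -
    have "(infdist (?q p) C)\<^sup>2 \<le> (dist (?q p) p)\<^sup>2"
      using p(1) by (intro power_mono infdist_le infdist_nonneg)
    then have "f (?q p) \<le> \<gamma> * (dist (?q p) p)\<^sup>2 + 1 / 2 * (norm (?q p - x))\<^sup>2"
      using \<gamma> unfolding f_def by simp
    also have "\<dots> = a / 2 * (infdist x C)\<^sup>2" by (subst square) (simp add: p(2))
    finally show ?thesis .
  qed
  \<comment> \<open>Here \<open>c\<close> is the point of \<open>C\<close> nearest to
    \<open>y\<close>, not to \<open>x\<close>. If \<open>y\<close> attains the lower bound, then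
    \<open>c\<close> is also nearest to \<open>x\<close>, so \<open>c = p\<close>, and the completed
    square vanishes.\<close>
  have f_ge: "a / 2 * (infdist x C)\<^sup>2 \<le> f y \<and> (f y \<le> a / 2 * (infdist x C)\<^sup>2 \<longrightarrow> y = ?q p)" for y
  proof -
    obtain c where c: "c \<in> C" "dist y c = infdist y C"
      using infdist_attained_complete_convex[OF C] p(1) by blast
    have fy: "f y = (\<gamma> + 1 / 2) * (norm (y - ?q c))\<^sup>2 + a / 2 * (dist x c)\<^sup>2"
      using square[of y c] c(2) by (simp add: f_def)
    have le: "(infdist x C)\<^sup>2 \<le> (dist x c)\<^sup>2"
      using c(1) by (intro power_mono infdist_le infdist_nonneg)
    have sq: "a / 2 * (infdist x C)\<^sup>2 \<le> a / 2 * (dist x c)\<^sup>2"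
      using le a0 by simp
    have pos: "(\<gamma> + 1 / 2) * (norm (y - ?q c))\<^sup>2 \<ge> 0" using \<gamma> by simp
    have "y = ?q p" if "f y \<le> a / 2 * (infdist x C)\<^sup>2"
    proof -
      have "a / 2 * (dist x c)\<^sup>2 \<le> a / 2 * (infdist x C)\<^sup>2" using that fy pos by linarith
      then have "(dist x c)\<^sup>2 \<le> (infdist x C)\<^sup>2" using a0 by simp
      then have "dist x c \<le> infdist x C" by (rule power2_le_imp_le) (rule infdist_nonneg)
      then have "c = p"
        using any_closest_point_unique[OF C(2,1) c(1) p(1), of x] p(2)
        by (metis infdist_le order_trans order_refl)
      moreover have "(\<gamma> + 1 / 2) * (norm (y - ?q c))\<^sup>2 = 0" using that fy pos sq by linarith
      ultimately show ?thesis using \<gamma> by simp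
    qed
    then show ?thesis using fy pos sq by linarith
  qed
  \<comment> \<open>Uniqueness of the minimizer pins down the value that the choice operator
    returns.\<close>
  have "is_arg_min f (\<lambda>_. True) = (\<lambda>y. y = ?q p)"
    using f_ge fq unfolding is_arg_min_def fun_eq_iff by (metis linorder_not_le order_trans)
  then have "arg_min f (\<lambda>_. True) = ?q p" unfolding arg_min_def by simp
  then show ?thesis unfolding prox_def f_def a_def .
qed

section \<open>Decrease of squared distances in one step\<close>

text \<open>Expanding the square leaves one cross term, \<open>inner (x - p) (c - p)\<close>, which
  is nonpositive by the variational characterization of the projection.\<close>

lemma relaxed_projection_dist:
  fixes C :: "'a::real_inner set"
  assumes C: "closed C" "convex C" and p: "p \<in> C" "dist x p = infdist x C"
    and c: "c \<in> C" and t: "t \<ge> 0"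
  shows "(norm (x + t *\<^sub>R (p - x) - c))\<^sup>2 \<le> (norm (x - c))\<^sup>2 - t * (2 - t) * (infdist x C)\<^sup>2"
proof -
  have "inner (x - p) (c - p) \<le> 0"
    using any_closest_point_dot[OF C(2,1) p(1) c] p(2) infdist_le by metis
  then have "t * inner (x - p) (c - p) \<le> 0" using t by (simp add: mult_nonneg_nonpos)
  moreover have "(norm (x + t *\<^sub>R (p - x) - c))\<^sup>2
      = (norm (x - c))\<^sup>2 - t * (2 - t) * (dist x p)\<^sup>2 + 2 * (t * inner (x - p) (c - p))"
    unfolding power2_norm_eq_inner dist_norm
    by (simp add: inner_commute algebra_simps power2_eq_square)
  ultimately show ?thesis by (simp add: p(2))
qed

lemma norm_convex_combination_square_le:
  fixes x y :: "'a::real_inner"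
  assumes "0 \<le> l" "l \<le> 1"
  shows "(norm ((1 - l) *\<^sub>R x + l *\<^sub>R y))\<^sup>2 \<le> (1 - l) * (norm x)\<^sup>2 + l * (norm y)\<^sup>2"
proof -
  have "(1 - l) * (norm x)\<^sup>2 + l * (norm y)\<^sup>2 - (norm ((1 - l) *\<^sub>R x + l *\<^sub>R y))\<^sup>2
      = l * (1 - l) * (norm (x - y))\<^sup>2"
    unfolding power2_norm_eq_inner
    by (simp add: inner_commute algebra_simps power2_eq_square)
  moreover have "l * (1 - l) * (norm (x - y))\<^sup>2 \<ge> 0" using assms by simp
  ultimately show ?thesis by linarith
qed

text \<open>Passing from \<open>z\<close> to \<open>2 *\<^sub>R xg - z\<close> doubles the
  relaxation parameter, giving an over-relaxed projection \<open>w\<close> of \<open>z\<close> onto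
  \<open>Cg\<close>; likewise \<open>v\<close> arises from \<open>w\<close> and \<open>Cf\<close>.
  The two decreases involve the distances of \<open>z\<close> to \<open>Cg\<close> and of
  \<open>w\<close> to \<open>Cf\<close>; the displacement from \<open>z\<close> to \<open>w\<close>
  turns the latter into a distance of \<open>z\<close>.\<close>

lemma averaged_relaxed_projections_dist:
  fixes Cf Cg :: "'a::{real_inner, complete_space} set"
  assumes Cf: "closed Cf" "convex Cf" and Cg: "closed Cg" "convex Cg"
    and pos: "\<gamma>f > 0" "\<gamma>g > 0" and l: "0 \<le> l" "l \<le> 1"
    and xg: "xg = prox (\<lambda>y. \<gamma>g * (infdist y Cg)\<^sup>2) z"
    and xf: "xf = prox (\<lambda>y. \<gamma>f * (infdist y Cf)\<^sup>2) (2 *\<^sub>R xg - z)"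
    and c: "c \<in> Cf \<inter> Cg"
  shows "(norm (z + (2 * l) *\<^sub>R (xf - xg) - c))\<^sup>2 \<le> (norm (z - c))\<^sup>2
      - 4 * l * min (\<gamma>g / (2 * \<gamma>g + 1)\<^sup>2) (\<gamma>f / (2 * \<gamma>f + 1)\<^sup>2)
        / max (16 * \<gamma>g\<^sup>2 / (2 * \<gamma>g + 1)\<^sup>2) 1 * (max (infdist z Cf) (infdist z Cg))\<^sup>2"
proof -
  define a where "a = 2 * \<gamma>g / (2 * \<gamma>g + 1)"
  define b where "b = 2 * \<gamma>f / (2 * \<gamma>f + 1)"
  define m where "m = min (\<gamma>g / (2 * \<gamma>g + 1)\<^sup>2) (\<gamma>f / (2 * \<gamma>f + 1)\<^sup>2)"
  define M where "M = max (16 * \<gamma>g\<^sup>2 / (2 * \<gamma>g + 1)\<^sup>2) 1"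
  have ab0: "a \<ge> 0" "b \<ge> 0" using pos by (auto simp: a_def b_def)
  \<comment> \<open>Since \<open>1 - a = 1 / (2 * \<gamma>g + 1)\<close>; this is the source of the
    terms inside \<open>min\<close>.\<close>
  have a1: "2 * a * (2 - 2 * a) = 8 * (\<gamma>g / (2 * \<gamma>g + 1)\<^sup>2)"
    using pos by (simp add: a_def divide_simps power2_eq_square)
  have b1: "2 * b * (2 - 2 * b) = 8 * (\<gamma>f / (2 * \<gamma>f + 1)\<^sup>2)"
    using pos by (simp add: b_def divide_simps power2_eq_square)
  have a2: "16 * \<gamma>g\<^sup>2 / (2 * \<gamma>g + 1)\<^sup>2 = (2 * a)\<^sup>2"
    by (simp add: a_def power_divide power_mult_distrib)
  obtain pg where pg: "pg \<in> Cg" "dist z pg = infdist z Cg"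
    using infdist_attained_complete_convex[OF Cg] c by blast
  define w where "w = z + (2 * a) *\<^sub>R (pg - z)"
  obtain pf where pf: "pf \<in> Cf" "dist w pf = infdist w Cf"
    using infdist_attained_complete_convex[OF Cf] c by blast
  define v where "v = w + (2 * b) *\<^sub>R (pf - w)"
  have xg': "xg = z + a *\<^sub>R (pg - z)"
    unfolding xg a_def by (rule prox_infdist_square[OF Cg pos(2) pg])
  have w: "2 *\<^sub>R xg - z = w"
    unfolding xg' w_def by (simp add: algebra_simps scaleR_2)
  have xf': "xf = w + b *\<^sub>R (pf - w)"
    unfolding xf w b_def by (rule prox_infdist_square[OF Cf pos(1) pf])
  have v: "2 *\<^sub>R xf - w = v"
    unfolding xf' v_def by (simp add: algebra_simps scaleR_2)
  \<comment> \<open>From \<open>w = 2 *\<^sub>R xg - z\<close> and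
    \<open>v = 2 *\<^sub>R xf - w\<close> follows
    \<open>v - z = 2 *\<^sub>R (xf - xg)\<close>.\<close>
  have "z + (2 * l) *\<^sub>R (xf - xg) - c = (1 - l) *\<^sub>R (z - c) + l *\<^sub>R (v - c)"
    unfolding v[symmetric] w[symmetric] by (simp add: algebra_simps)
  then have avg: "(norm (z + (2 * l) *\<^sub>R (xf - xg) - c))\<^sup>2
      \<le> (1 - l) * (norm (z - c))\<^sup>2 + l * (norm (v - c))\<^sup>2"
    using norm_convex_combination_square_le[OF l] by simp
  have "(norm (w - c))\<^sup>2 \<le> (norm (z - c))\<^sup>2 - 8 * (\<gamma>g / (2 * \<gamma>g + 1)\<^sup>2) * (infdist z Cg)\<^sup>2"
    using relaxed_projection_dist[OF Cg pg, of c "2 * a"] c ab0 unfolding w_def a1 by simp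
  moreover have "(norm (v - c))\<^sup>2
      \<le> (norm (w - c))\<^sup>2 - 8 * (\<gamma>f / (2 * \<gamma>f + 1)\<^sup>2) * (infdist w Cf)\<^sup>2"
    using relaxed_projection_dist[OF Cf pf, of c "2 * b"] c ab0 unfolding v_def b1 by simp
  moreover have "m * (infdist z Cg)\<^sup>2 \<le> \<gamma>g / (2 * \<gamma>g + 1)\<^sup>2 * (infdist z Cg)\<^sup>2"
    "m * (infdist w Cf)\<^sup>2 \<le> \<gamma>f / (2 * \<gamma>f + 1)\<^sup>2 * (infdist w Cf)\<^sup>2"
    by (intro mult_right_mono; simp add: m_def)+
  ultimately have vc: "(norm (v - c))\<^sup>2
      \<le> (norm (z - c))\<^sup>2 - 8 * m * ((infdist z Cg)\<^sup>2 + (infdist w Cf)\<^sup>2)"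
    unfolding distrib_left mult.assoc by linarith
  \<comment> \<open>The step from \<open>z\<close> to \<open>w\<close> has length
    \<open>2 * a * infdist z Cg\<close>, whose squared coefficient is the first entry of
    \<open>M\<close>. The 2 comes from
    \<open>(s + t)\<^sup>2 \<le> 2 * s\<^sup>2 + 2 * t\<^sup>2\<close> and reduces the constant 8 of
    the decrease to 4.\<close>
  have D: "(max (infdist z Cf) (infdist z Cg))\<^sup>2
      \<le> 2 * M * ((infdist z Cg)\<^sup>2 + (infdist w Cf)\<^sup>2)" (is "_ \<le> ?B")
  proof -
    have M1: "M \<ge> 1" "M \<ge> (2 * a)\<^sup>2" by (simp_all add: M_def a2)
    have MG: "(2 * a)\<^sup>2 * (infdist z Cg)\<^sup>2 \<le> M * (infdist z Cg)\<^sup>2"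
      "1 * (infdist z Cg)\<^sup>2 \<le> M * (infdist z Cg)\<^sup>2"
      "1 * (infdist w Cf)\<^sup>2 \<le> M * (infdist w Cf)\<^sup>2"
      by (rule mult_right_mono[OF M1(2) zero_le_power2] mult_right_mono[OF M1(1) zero_le_power2])+
    have "dist z w = 2 * a * infdist z Cg"
      unfolding w_def pg(2)[symmetric] using ab0 by (simp add: dist_norm norm_minus_commute)
    then have "infdist z Cf \<le> infdist w Cf + 2 * a * infdist z Cg"
      using infdist_triangle[of z Cf w] by simp
    then have "(infdist z Cf)\<^sup>2 \<le> (infdist w Cf + 2 * a * infdist z Cg)\<^sup>2"
      by (intro power_mono infdist_nonneg)
    also have "\<dots> \<le> 2 * (infdist w Cf)\<^sup>2 + 2 * (2 * a * infdist z Cg)\<^sup>2"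
      using zero_le_power2[of "infdist w Cf - 2 * a * infdist z Cg"]
      by (simp add: power2_sum power2_diff)
    also have "\<dots> \<le> ?B" using MG by (simp add: power_mult_distrib algebra_simps)
    finally have "(infdist z Cf)\<^sup>2 \<le> ?B" .
    moreover have "(infdist z Cg)\<^sup>2 \<le> ?B"
      using MG zero_le_power2[of "infdist w Cf"] zero_le_power2[of "infdist z Cg"]
      unfolding distrib_left mult.assoc by linarith
    ultimately show ?thesis by (simp add: max_def)
  qed
  have M0: "M > 0" by (simp add: M_def)
  have m0: "m \<ge> 0" using pos by (simp add: m_def)
  have "4 * l * m / M * (max (infdist z Cf) (infdist z Cg))\<^sup>2 \<le> 4 * l * m / M * ?B"
    using D M0 m0 l(1) by (intro mult_left_mono) auto
  also have "\<dots> = l * (8 * m * ((infdist z Cg)\<^sup>2 + (infdist w Cf)\<^sup>2))" using M0 by simp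
  also have "\<dots> \<le> l * ((norm (z - c))\<^sup>2 - (norm (v - c))\<^sup>2)"
    using vc l(1) by (intro mult_left_mono) auto
  also have "\<dots> \<le> (norm (z - c))\<^sup>2 - (norm (z + (2 * l) *\<^sub>R (xf - xg) - c))\<^sup>2"
    using avg by (simp add: algebra_simps)
  finally show ?thesis unfolding m_def M_def by linarith
qed

section \<open>Convergence of Fejer monotone sequences\<close>

text \<open>All later terms stay in the closed ball about the projection of \<open>z k\<close> onto
  \<open>S\<close> with radius \<open>infdist (z k) S\<close>, so they are within its diameter of
  \<open>z k\<close>. This gives the Cauchy property and, in the limit, the error bound.\<close>

lemma fejer_convergence:
  fixes z :: "nat \<Rightarrow> 'a::{real_inner, complete_space}"
  assumes S: "closed S" "convex S" "S \<noteq> {}"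
    and fejer: "\<And>k c. c \<in> S \<Longrightarrow> norm (z (Suc k) - c) \<le> norm (z k - c)"
    and lim: "(\<lambda>k. infdist (z k) S) \<longlonglongrightarrow> 0"
  obtains x where "x \<in> S" "z \<longlonglongrightarrow> x" "\<And>k. norm (z k - x) \<le> 2 * infdist (z k) S"
proof -
  have near: "norm (z k - z j) \<le> 2 * infdist (z k) S" if "k \<le> j" for j k
  proof -
    obtain p where p: "p \<in> S" "dist (z k) p = infdist (z k) S"
      using infdist_attained_complete_convex[OF S] by blast
    have "norm (z j - p) \<le> norm (z k - p)"
      using lift_Suc_antimono_le[of "\<lambda>j. norm (z j - p)"] fejer[OF p(1)] that by blast
    moreover have "norm (z k - z j) \<le> norm (z k - p) + norm (z j - p)"
      using norm_triangle_ineq4[of "z k - p" "z j - p"] by simp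
    ultimately show ?thesis using p(2) by (simp add: dist_norm)
  qed
  have "Cauchy z"
  proof (rule metric_CauchyI)
    fix e :: real assume e: "e > 0"
    \<comment> \<open>Then all terms from \<open>N\<close> on are within \<open>e / 2\<close> of
      \<open>z N\<close>.\<close>
    obtain N where N: "infdist (z N) S < e / 4"
      using order_tendstoD(2)[OF lim, of "e / 4"] e by (auto simp: eventually_sequentially)
    have "dist (z m) (z n) < e" if "m \<ge> N" "n \<ge> N" for m n
      using near[OF that(1)] near[OF that(2)] N dist_triangle3[of "z m" "z n" "z N"]
      by (simp add: dist_norm)
    then show "\<exists>N. \<forall>m\<ge>N. \<forall>n\<ge>N. dist (z m) (z n) < e" by blast
  qed
  then obtain x where x: "z \<longlonglongrightarrow> x" using Cauchy_convergent convergent_def by blast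
  have "infdist x S = 0"
    using LIMSEQ_unique[OF tendsto_infdist[OF x] lim] .
  then have "x \<in> S" using S in_closed_iff_infdist_zero by blast
  moreover have "norm (z k - x) \<le> 2 * infdist (z k) S" for k
  proof (rule LIMSEQ_le_const2)
    show "(\<lambda>j. norm (z k - z j)) \<longlonglongrightarrow> norm (z k - x)" by (intro tendsto_intros x)
    show "\<exists>N. \<forall>j\<ge>N. norm (z k - z j) \<le> 2 * infdist (z k) S" using near by blast
  qed
  ultimately show thesis using that x by blast
qed

section \<open>Bounds on the contraction factor\<close>

lemma contraction_factor_le_1:
  assumes "\<gamma>f > 0" "\<gamma>g > 0" "l \<ge> 0"
  shows "contraction_factor \<gamma>f \<gamma>g l \<mu> \<le> 1"
  using assms unfolding contraction_factor_def
  by (subst real_sqrt_le_1_iff) (auto intro!: divide_nonneg_nonneg mult_nonneg_nonneg)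

text \<open>From \<open>4 * \<gamma>g \<le> (2 * \<gamma>g + 1)\<^sup>2\<close> the minimum is at
  most \<open>1 / 4\<close>, so the numerator is at most 1, while \<open>\<mu> \<ge> 1\<close> keeps
  the denominator at least 1.\<close>

lemma contraction_factor_nonneg:
  assumes "\<gamma>f > 0" "\<gamma>g > 0" "0 \<le> l" "l \<le> 1" "\<mu> \<ge> 1"
  shows "contraction_factor \<gamma>f \<gamma>g l \<mu> \<ge> 0"
proof -
  let ?m = "min (\<gamma>g / (2 * \<gamma>g + 1)\<^sup>2) (\<gamma>f / (2 * \<gamma>f + 1)\<^sup>2)"
  let ?M = "max (16 * \<gamma>g\<^sup>2 / (2 * \<gamma>g + 1)\<^sup>2) 1"
  have "4 * \<gamma>g \<le> (2 * \<gamma>g + 1)\<^sup>2"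
    using assms(2) by (simp add: power2_eq_square algebra_simps)
  then have "\<gamma>g / (2 * \<gamma>g + 1)\<^sup>2 \<le> 1 / 4" using assms(2) by (simp add: field_simps)
  then have m: "?m \<le> 1 / 4" by linarith
  have m0: "?m \<ge> 0" using assms(1,2) by simp
  have "l * (4 * ?m) \<le> 1 * 1" using assms(3,4) m m0 by (intro mult_mono) auto
  moreover have "1 * 1 \<le> \<mu>\<^sup>2 * ?M" using assms(5) by (intro mult_mono) (auto simp: one_le_power)
  ultimately have "4 * l * ?m / (\<mu>\<^sup>2 * ?M) \<le> 1"
    by (subst divide_le_eq_1) (auto simp: algebra_simps)
  then show ?thesis unfolding contraction_factor_def by simp
qed

section \<open>Contraction and linear convergence of the iteration\<close>

theorem theorem8:
  fixes Cf Cg :: "'a::{real_inner, complete_space} set"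
    and z xg xf :: "nat \<Rightarrow> 'a"
    and \<gamma>f \<gamma>g l :: "nat \<Rightarrow> real"
    and \<rho> \<mu> :: real
  assumes "closed Cf" "convex Cf" "closed Cg" "convex Cg"
    and "Cf \<inter> Cg \<noteq> {}"
    and "boundedly_linearly_regular {Cf, Cg}"
    and "\<And>k. \<gamma>f k > 0" "\<And>k. \<gamma>g k > 0"
    and "\<And>k. l k \<in> {0<..1}"
    and "\<And>k. xg k = prox (\<lambda>y. \<gamma>g k * (infdist y Cg)\<^sup>2) (z k)"
    and "\<And>k. xf k = prox (\<lambda>y. \<gamma>f k * (infdist y Cf)\<^sup>2) (2 *\<^sub>R xg k - z k)"
    and "\<And>k. z (Suc k) = z k + (2 * l k) *\<^sub>R (xf k - xg k)"
    and "\<rho> > 0" "\<mu> > 0"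
    and "range z \<subseteq> ball 0 \<rho>"
    and "\<And>x. x \<in> ball 0 \<rho> \<Longrightarrow>
           infdist x (Cf \<inter> Cg) \<le> \<mu> * max (infdist x Cf) (infdist x Cg)"
  shows "(\<forall>k. infdist (z (Suc k)) (Cf \<inter> Cg)
              \<le> contraction_factor (\<gamma>f k) (\<gamma>g k) (l k) \<mu> * infdist (z k) (Cf \<inter> Cg)) \<and>
         ((SUP j. contraction_factor (\<gamma>f j) (\<gamma>g j) (l j) \<mu>) < 1 \<longrightarrow>
           (\<exists>x \<in> Cf \<inter> Cg.
              converges_linearly z x (SUP j. contraction_factor (\<gamma>f j) (\<gamma>g j) (l j) \<mu>) \<and>
              (\<forall>k. norm (z k - x) \<le> 2 * infdist (z 0) (Cf \<inter> Cg) *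
                     (\<Prod>i<k. contraction_factor (\<gamma>f i) (\<gamma>g i) (l i) \<mu>))))"
proof -
  define S where "S = Cf \<inter> Cg"
  define K where "K = (\<lambda>k. contraction_factor (\<gamma>f k) (\<gamma>g k) (l k) \<mu>)"
  define d where "d = (\<lambda>k. infdist (z k) S)"
  have S: "closed S" "convex S" "S \<noteq> {}"
    unfolding S_def using assms(1-5) by (auto intro: convex_Int)
  have l: "0 \<le> l k" "l k \<le> 1" for k using assms(9)[of k] by auto
  have d0: "d k \<ge> 0" for k by (simp add: d_def infdist_nonneg)
  have reg: "d k \<le> \<mu> * max (infdist (z k) Cf) (infdist (z k) Cg)" for k
    using assms(15,16) unfolding d_def S_def by blast
  \<comment> \<open>The subtracted term of the radicand freed of \<open>\<mu>\<^sup>2\<close>, so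
    that \<open>K k = sqrt (1 - A k / \<mu>\<^sup>2)\<close>.\<close>
  define A where "A = (\<lambda>k. 4 * l k * min (\<gamma>g k / (2 * \<gamma>g k + 1)\<^sup>2) (\<gamma>f k / (2 * \<gamma>f k + 1)\<^sup>2)
    / max (16 * (\<gamma>g k)\<^sup>2 / (2 * \<gamma>g k + 1)\<^sup>2) 1)"
  have A0: "A k \<ge> 0" for k
    using l(1)[of k] assms(7,8)[of k] unfolding A_def
    by (auto intro!: divide_nonneg_nonneg mult_nonneg_nonneg)
  have step: "(norm (z (Suc k) - c))\<^sup>2
      \<le> (norm (z k - c))\<^sup>2 - A k * (max (infdist (z k) Cf) (infdist (z k) Cg))\<^sup>2"
    if "c \<in> S" for k c
    unfolding assms(12) A_def
    by (rule averaged_relaxed_projections_dist[OF assms(1-4,7,8) l assms(10,11)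
          that[unfolded S_def]])
  have fejer: "norm (z (Suc k) - c) \<le> norm (z k - c)" if "c \<in> S" for k c
  proof -
    have "(norm (z (Suc k) - c))\<^sup>2 \<le> (norm (z k - c))\<^sup>2"
      using step[OF that, of k]
        mult_nonneg_nonneg[OF A0[of k]
          zero_le_power2[of "max (infdist (z k) Cf) (infdist (z k) Cg)"]]
      by linarith
    then show ?thesis by (rule power2_le_imp_le) simp
  qed
  have contract: "d (Suc k) \<le> K k * d k" for k
  proof -
    \<comment> \<open>Comparing with the projection of the current iterate makes the old distance
      exactly \<open>d k\<close>, while the new distance to \<open>p\<close> bounds
      \<open>d (Suc k)\<close> from above.\<close>
    obtain p where p: "p \<in> S" "dist (z k) p = d k"
      using infdist_attained_complete_convex[OF S] unfolding d_def by blast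
    have "(d k)\<^sup>2 \<le> (\<mu> * max (infdist (z k) Cf) (infdist (z k) Cg))\<^sup>2"
      using reg d0 by (intro power_mono)
    then have "(d k)\<^sup>2 / \<mu>\<^sup>2 \<le> (max (infdist (z k) Cf) (infdist (z k) Cg))\<^sup>2"
      using assms(14) by (simp add: power_mult_distrib divide_le_eq mult.commute)
    then have dA: "A k * ((d k)\<^sup>2 / \<mu>\<^sup>2)
        \<le> A k * (max (infdist (z k) Cf) (infdist (z k) Cg))\<^sup>2"
      using A0 by (intro mult_left_mono)
    have "(d (Suc k))\<^sup>2 \<le> (norm (z (Suc k) - p))\<^sup>2"
      using infdist_le[OF p(1), of "z (Suc k)"] d0
      by (intro power_mono) (auto simp: d_def dist_norm)
    also have "\<dots> \<le> (d k)\<^sup>2 - A k * ((d k)\<^sup>2 / \<mu>\<^sup>2)"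
      using step[OF p(1), of k] dA p(2) by (simp add: dist_norm)
    also have "\<dots> = (1 - A k / \<mu>\<^sup>2) * (d k)\<^sup>2" by (simp add: algebra_simps)
    \<comment> \<open>\<open>sqrt\<close> is odd, monotone and multiplicative on all reals, so a
      negative radicand requires no separate case.\<close>
    finally have "sqrt ((d (Suc k))\<^sup>2) \<le> sqrt ((1 - A k / \<mu>\<^sup>2) * (d k)\<^sup>2)"
      by (rule real_sqrt_le_mono)
    then show ?thesis using d0
      by (simp add: real_sqrt_mult K_def contraction_factor_def A_def mult.commute)
  qed
  \<comment> \<open>Boundedness makes the real supremum \<open>r\<close> a genuine upper bound of
    the factors.\<close>
  have bdd: "bdd_above (range K)"
    using contraction_factor_le_1 assms(7,8) l unfolding K_def
    by (intro bdd_aboveI[of _ 1]) blast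
  define r where "r = (SUP j. K j)"
  have Kr: "K j \<le> r" for j unfolding r_def by (rule cSUP_upper[OF _ bdd]) simp
  have main: "\<exists>x \<in> S. converges_linearly z x r \<and>
      (\<forall>k. norm (z k - x) \<le> 2 * d 0 * (\<Prod>i<k. K i))" if r1: "r < 1"
    \<comment> \<open>If \<open>d 0 = 0\<close>, then \<open>\<mu> < 1\<close> and negative factors are possible, but the sequence is constant.\<close>
  proof (cases "d 0 = 0")
    case True
    then have z0: "z 0 \<in> S" using S in_closed_iff_infdist_zero unfolding d_def by blast
    have const: "z k = z 0" for k
    proof (induction k)
      case (Suc k)
      then show ?case using fejer[OF z0, of k] by simp
    qed simp
    have "z = (\<lambda>_. z 0)" using const by blast
    then have "z \<longlonglongrightarrow> z 0" by (metis tendsto_const)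
    \<comment> \<open>The witness \<open>M = 0\<close> works whatever the sign of
      \<open>r\<close>.\<close>
    then have "converges_linearly z (z 0) r"
      unfolding converges_linearly_def using r1 const by (auto intro!: exI[of _ 0])
    moreover have "\<forall>k. norm (z k - z 0) \<le> 2 * d 0 * (\<Prod>i<k. K i)" using const True by simp
    ultimately show ?thesis using z0 by blast
  next
    case False
    then have dpos: "d 0 > 0" using d0[of 0] by simp
    \<comment> \<open>\<open>S\<close> lies in both sets, so its distance dominates theirs; with
      \<open>d 0 > 0\<close>, regularity then forces \<open>\<mu> \<ge> 1\<close>. The factors are
      thus nonnegative and the contraction can be iterated.\<close>
    have "max (infdist (z 0) Cf) (infdist (z 0) Cg) \<le> d 0"
      using infdist_mono[of S _ "z 0"] S(3) unfolding d_def S_def by simp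
    then have "d 0 \<le> \<mu> * d 0"
      using reg[of 0] assms(14) by (meson mult_left_mono less_imp_le order_trans)
    then have \<mu>: "\<mu> \<ge> 1" using dpos by simp
    have K0: "K k \<ge> 0" for k
      unfolding K_def using contraction_factor_nonneg assms(7,8) l \<mu> by blast
    have r0: "r \<ge> 0" using K0[of 0] Kr[of 0] by linarith
    have d_prod: "d k \<le> d 0 * (\<Prod>i<k. K i)" for k
    proof (induction k)
      case (Suc k)
      have "d (Suc k) \<le> K k * (d 0 * (\<Prod>i<k. K i))"
        using contract[of k] mult_left_mono[OF Suc K0[of k]] by linarith
      then show ?case by (simp add: ac_simps)
    qed simp
    have prod_r: "(\<Prod>i<k. K i) \<le> r ^ k" for k
      using prod_mono[of "{..<k}" K "\<lambda>_. r"] K0 Kr by simp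
    have d_r: "d k \<le> d 0 * r ^ k" for k
      using d_prod[of k] mult_left_mono[OF prod_r[of k] d0[of 0]] by linarith
    have "(\<lambda>k. d 0 * r ^ k) \<longlonglongrightarrow> d 0 * 0"
      using r0 r1 by (intro tendsto_intros) auto
    then have "(\<lambda>k. infdist (z k) S) \<longlonglongrightarrow> 0"
      using tendsto_sandwich[of "\<lambda>_. 0" d sequentially "\<lambda>k. d 0 * r ^ k" 0] d0 d_r
      by (simp add: d_def)
    then obtain x where x: "x \<in> S" "z \<longlonglongrightarrow> x" "\<And>k. norm (z k - x) \<le> 2 * d k"
      using fejer_convergence[OF S, of z] fejer unfolding d_def by blast
    have "norm (z k - x) \<le> (2 * d 0) * r ^ k" for k
      using x(3)[of k] d_r[of k] by simp
    then have "converges_linearly z x r"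
      unfolding converges_linearly_def using r1 x(2) d0[of 0]
      by (auto intro!: exI[of _ "2 * d 0"])
    moreover have "\<forall>k. norm (z k - x) \<le> 2 * d 0 * (\<Prod>i<k. K i)"
    proof
      fix k show "norm (z k - x) \<le> 2 * d 0 * (\<Prod>i<k. K i)"
        using x(3)[of k] d_prod[of k] by simp
    qed
    ultimately show ?thesis using x(1) by blast
  qed
  show ?thesis using contract main unfolding r_def K_def d_def S_def by blast
qed

end
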